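(* Let $\alpha\in[2,3]$ be the fixed energy exponent. For every instance with $n$ jobs, every deadline profile $d$ with $d_j>r_j$ for all $j$, and every player $i$, the marginal cost share of $i$ is at least his proportional cost share and at most $\alpha$ times his proportional cost share: $$\mathrm{prop}_i(d)\ \le\ E(\mathrm{OPT}(d)) - E(\mathrm{OPT}(d_{-i}))\ \le\ \alpha\cdot \mathrm{prop}_i(d).$$
   Context: Speed scaling model. A single machine can run at any speed $s(t)\ge 0$ at time $t$; in a time interval $I$ it executes workload $\int_I s(t)\,dt$ and consumes energy $\int_I s(t)^\alpha\,dt$, where $\alpha\in[2,3]$ is a fixed constant. There are $n$ jobs; job $i$ (owned by player $i$) has workload $w_i>0$, release time $r_i$ and deadline $d_i>r_i$. A (preemptive) schedule specifies a speed function and, at each time, at most one job being processed at that speed; it is feasible if each job $i$ receives total workload $w_i$, all of it within $[r_i,d_i]$. $\mathrm{OPT}(d)$ denotes the feasible schedule of minimum energy for deadlines $d=(d_1,\dots,d_n)$, in which jobs are executed in preemptive earliest-deadline-first order (ties broken by job index); its speed function is piecewise constant and each job is executed at constant speed. $\mathrm{OPT}(d_{-i})$ denotes the minimum energy schedule for the instance from which job $i$ is removed, and $E(S)$ denotes the energy of a schedule $S$. The marginal cost share of player $i$ is $E(\mathrm{OPT}(d))-E(\mathrm{OPT}(d_{-i}))$. The proportional cost share $\mathrm{prop}_i(d)$ of player $i$ is the energy consumed in $\mathrm{OPT}(d)$ during the execution of job $i$ (equal to $s^{\alpha-1}w_i$ if job $i$ is executed at constant speed $s$). *)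

theory Defs
  imports "HOL-Analysis.Analysis"
begin

record schedule =
  speed :: "real \<Rightarrow> real"
  job :: "real \<Rightarrow> nat option"   \<comment> \<open>\<open>None\<close>: no job is being processed\<close>

definition exec_times :: "schedule \<Rightarrow> nat \<Rightarrow> real set" where
  "exec_times S i = {t. job S t = Some i}"

definition energy :: "real \<Rightarrow> schedule \<Rightarrow> real" where
  "energy \<alpha> S = (LINT t|lborel. speed S t powr \<alpha>)"

definition job_energy :: "real \<Rightarrow> schedule \<Rightarrow> nat \<Rightarrow> real" where
  "job_energy \<alpha> S i = (LINT t:exec_times S i|lborel. speed S t powr \<alpha>)"

text \<open>
  Feasibility for the instance with job set \<open>J\<close>. The Bochner integral of a non-integrable
  function is 0, so integrability is required explicitly. For \<open>energy\<close> this says that the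
  energy is finite, which loses nothing when minimising.
\<close>
definition feasible ::
    "real \<Rightarrow> (nat \<Rightarrow> real) \<Rightarrow> (nat \<Rightarrow> real) \<Rightarrow> (nat \<Rightarrow> real) \<Rightarrow> nat set \<Rightarrow> schedule \<Rightarrow> bool" where
  "feasible \<alpha> w r d J S \<longleftrightarrow>
     speed S \<in> borel_measurable borel \<and>
     job S \<in> measurable borel (count_space UNIV) \<and>
     (\<forall>t. 0 \<le> speed S t) \<and>
     integrable lborel (\<lambda>t. speed S t powr \<alpha>) \<and>
     (\<forall>t i. job S t = Some i \<longrightarrow> i \<in> J) \<and>
     (\<forall>i\<in>J. exec_times S i \<subseteq> {r i..d i} \<and>
        set_integrable lborel (exec_times S i) (speed S) \<and>
        (LINT t:exec_times S i|lborel. speed S t) = w i)"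

definition work_until :: "schedule \<Rightarrow> nat \<Rightarrow> real \<Rightarrow> real" where
  "work_until S i t = (LINT u:exec_times S i \<inter> {..t}|lborel. speed S u)"

definition precedes :: "(nat \<Rightarrow> real) \<Rightarrow> nat \<Rightarrow> nat \<Rightarrow> bool" where
  "precedes d j i \<longleftrightarrow> d j < d i \<or> d j = d i \<and> j < i"

text \<open>
  Preemptive earliest deadline first: whenever a job is being processed, every released job
  that precedes it is already completed.
\<close>
definition edf ::
    "(nat \<Rightarrow> real) \<Rightarrow> (nat \<Rightarrow> real) \<Rightarrow> (nat \<Rightarrow> real) \<Rightarrow> nat set \<Rightarrow> schedule \<Rightarrow> bool" where
  "edf w r d J S \<longleftrightarrow>
     (\<forall>t i j. job S t = Some i \<and> j \<in> J \<and> r j \<le> t \<and> precedes d j i \<longrightarrow> w j \<le> work_until S j t)"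

definition is_OPT ::
    "real \<Rightarrow> (nat \<Rightarrow> real) \<Rightarrow> (nat \<Rightarrow> real) \<Rightarrow> (nat \<Rightarrow> real) \<Rightarrow> nat set \<Rightarrow> schedule \<Rightarrow> bool" where
  "is_OPT \<alpha> w r d J S \<longleftrightarrow>
     feasible \<alpha> w r d J S \<and>
     (\<forall>T. feasible \<alpha> w r d J T \<longrightarrow> energy \<alpha> S \<le> energy \<alpha> T) \<and>
     edf w r d J S"

text \<open>
  Such a schedule is unique only up to null sets and idle time; neither affects \<open>energy\<close> or
  \<open>job_energy\<close>.
\<close>
definition OPT ::
    "real \<Rightarrow> (nat \<Rightarrow> real) \<Rightarrow> (nat \<Rightarrow> real) \<Rightarrow> (nat \<Rightarrow> real) \<Rightarrow> nat set \<Rightarrow> schedule" where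
  "OPT \<alpha> w r d J = (SOME S. is_OPT \<alpha> w r d J S)"

definition marginal_share ::
    "real \<Rightarrow> (nat \<Rightarrow> real) \<Rightarrow> (nat \<Rightarrow> real) \<Rightarrow> (nat \<Rightarrow> real) \<Rightarrow> nat set \<Rightarrow> nat \<Rightarrow> real" where
  "marginal_share \<alpha> w r d J i =
     energy \<alpha> (OPT \<alpha> w r d J) - energy \<alpha> (OPT \<alpha> w r d (J - {i}))"

definition proportional_share ::
    "real \<Rightarrow> (nat \<Rightarrow> real) \<Rightarrow> (nat \<Rightarrow> real) \<Rightarrow> (nat \<Rightarrow> real) \<Rightarrow> nat set \<Rightarrow> nat \<Rightarrow> real" where
  "proportional_share \<alpha> w r d J i = job_energy \<alpha> (OPT \<alpha> w r d J) i"

end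

theory Submission
  imports Defs
begin

text \<open>
  Lower bound: deleting job \<open>i\<close> from an optimal schedule \<open>S\<close> gives a schedule for the remaining
  jobs that saves exactly the energy \<open>P\<close> spent on \<open>i\<close>.

  Upper bound: let \<open>T\<close> be a schedule without job \<open>i\<close>. Processing all jobs according to
  \<open>(1 - e) S + e T\<close> and job \<open>i\<close> additionally according to \<open>e S\<close> does all the work. By convexity of the
  power function this costs at most
  \<open>(1 - e) (E(S) - P) + (1 - e) powr (1 - \<alpha>) P + e E(T)\<close>. Comparing with \<open>E(S)\<close>, dividing by \<open>e\<close>
  and letting \<open>e\<close> tend to 0 gives \<open>E(S) - E(T) \<le> \<alpha> P\<close>.

  Both arguments use only optimality of the energy, but they need an optimal schedule to exist.
  Cut time at all release times and deadlines. By Jensen's inequality only the amount of work of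
  each job in each slice matters, so the energy is minimised by compactness; an
  exchange argument then makes the minimiser EDF.
\<close>

section \<open>Convexity of the power function and Jensen's inequality\<close>

text \<open>The convexity argument lives on the open half-line; the end points \<open>c = 0\<close>
  and \<open>y = 0\<close> are handled separately, using \<open>0 powr p = 0\<close>.\<close>

lemma powr_above_tangent:
  fixes \<alpha> c y :: real
  assumes "1 \<le> \<alpha>" "0 \<le> c" "0 \<le> y"
  shows "c powr \<alpha> + \<alpha> * c powr (\<alpha> - 1) * (y - c) \<le> y powr \<alpha>"
proof (cases "c = 0")
  case False
  then have c: "0 < c" using assms by simp
  have cc: "c powr (\<alpha> - 1) * c = c powr \<alpha>"
    using c by (simp add: powr_diff)
  show ?thesis
  proof (cases "y = 0")
    case True
    have "c powr \<alpha> \<le> \<alpha> * c powr \<alpha>"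
      using assms(1) mult_right_mono[of 1 \<alpha> "c powr \<alpha>"] by simp
    then show ?thesis using True cc by (simp add: algebra_simps)
  next
    case False
    have "y powr \<alpha> - c powr \<alpha> \<ge> \<alpha> * c powr (\<alpha> - 1) * (y - c)"
    proof (rule convex_on_imp_above_tangent[where A = "{0<..}"])
      show "convex_on {0<..} (\<lambda>x. x powr \<alpha>)" by (rule powr_convex[OF assms(1)])
      show "((\<lambda>x. x powr \<alpha>) has_real_derivative \<alpha> * c powr (\<alpha> - 1)) (at c within {0<..})"
        using c by (auto intro!: derivative_eq_intros simp: powr_diff)
    qed (use False c assms in \<open>auto simp: interior_open\<close>)
    then show ?thesis by simp
  qed
qed simp

text \<open>Add the tangent inequalities at the mixture \<open>c\<close> with weights
  \<open>1 - e\<close> and \<open>e\<close>: the linear terms cancel.\<close>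

lemma powr_convex_combination:
  fixes \<alpha> e u v :: real
  assumes "1 \<le> \<alpha>" "0 \<le> u" "0 \<le> v" "0 \<le> e" "e \<le> 1"
  shows "((1 - e) * u + e * v) powr \<alpha> \<le> (1 - e) * u powr \<alpha> + e * v powr \<alpha>"
proof -
  define c where "c = (1 - e) * u + e * v"
  have c: "0 \<le> c" using assms by (simp add: c_def)
  define D where "D = \<alpha> * c powr (\<alpha> - 1)"
  have "(1 - e) * (c powr \<alpha> + D * (u - c)) + e * (c powr \<alpha> + D * (v - c))
      \<le> (1 - e) * u powr \<alpha> + e * v powr \<alpha>"
    unfolding D_def using assms c by (intro add_mono mult_left_mono powr_above_tangent) auto
  moreover have "(1 - e) * (c powr \<alpha> + D * (u - c)) + e * (c powr \<alpha> + D * (v - c)) = c powr \<alpha>"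
    by (simp add: c_def algebra_simps)
  ultimately show ?thesis by (simp add: c_def)
qed

text \<open>Domination: \<open>g \<le> 1 + g powr \<alpha>\<close> pointwise, and constants are
  integrable on a set of finite measure.\<close>

lemma set_integrable_powr_imp_set_integrable:
  fixes g :: "real \<Rightarrow> real"
  assumes "1 \<le> \<alpha>" and [measurable]: "g \<in> borel_measurable borel" "A \<in> sets borel"
    and "\<And>t. 0 \<le> g t" and "integrable lborel (\<lambda>t. g t powr \<alpha>)" and "emeasure lborel A < \<infinity>"
  shows "set_integrable lborel A g"
  unfolding set_integrable_def
proof (rule Bochner_Integration.integrable_bound)
  show "integrable lborel (\<lambda>t. indicator A t + g t powr \<alpha>)"
    using assms by (intro Bochner_Integration.integrable_add) auto
  have "g t \<le> 1 + g t powr \<alpha>" for t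
  proof (cases "g t \<le> 1")
    case True then show ?thesis by (simp add: add_increasing2)
  next
    case False
    then have "g t powr 1 \<le> g t powr \<alpha>" using assms(1) by (intro powr_mono) auto
    then show ?thesis using assms(4)[of t] by simp
  qed
  then show "AE t in lborel. norm (indicator A t *\<^sub>R g t) \<le> norm (indicator A t + g t powr \<alpha>)"
    using assms(4) by (intro AE_I2) (auto simp: indicator_def)
qed simp

text \<open>Integrate the tangent inequality at the mean value \<open>c\<close> of \<open>g\<close>;
  its linear term integrates to zero.\<close>

lemma Jensen_powr_interval:
  fixes g :: "real \<Rightarrow> real"
  assumes "1 \<le> \<alpha>" "g \<in> borel_measurable borel" "\<And>t. 0 \<le> g t"
    and int: "integrable lborel (\<lambda>t. g t powr \<alpha>)" and ab: "a < b"
  shows "(b - a) * ((LINT t:{a..<b}|lborel. g t) / (b - a)) powr \<alpha>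
    \<le> (LINT t:{a..<b}|lborel. g t powr \<alpha>)"
proof -
  let ?I = "{a..<b}"
  define c where "c = (LINT t:?I|lborel. g t) / (b - a)"
  define D where "D = \<alpha> * c powr (\<alpha> - 1)"
  have gi: "set_integrable lborel ?I g"
    using assms by (intro set_integrable_powr_imp_set_integrable) auto
  have c: "0 \<le> c"
    unfolding c_def set_lebesgue_integral_def using assms
    by (intro divide_nonneg_pos integral_nonneg_AE AE_I2) auto
  have ki: "set_integrable lborel ?I (\<lambda>t. k)" for k :: real
    using ab by (simp add: set_integrable_def)
  have "(LINT t:?I|lborel. c powr \<alpha> - D * c + D * g t) \<le> (LINT t:?I|lborel. g t powr \<alpha>)"
  proof (rule set_integral_mono)
    show "set_integrable lborel ?I (\<lambda>t. g t powr \<alpha>)"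
      unfolding set_integrable_def using int by (intro integrable_mult_indicator) auto
    show "c powr \<alpha> - D * c + D * g t \<le> g t powr \<alpha>" for t
      using powr_above_tangent[OF assms(1) c assms(3)[of t]] by (simp add: D_def algebra_simps)
  qed (use gi ki in \<open>auto intro!: set_integral_add\<close>)
  moreover have "(LINT t:?I|lborel. c powr \<alpha> - D * c + D * g t)
      = (LINT t:?I|lborel. c powr \<alpha> - D * c) + (LINT t:?I|lborel. D * g t)"
    using ki gi by (intro set_integral_add(2)) auto
  moreover have "(LINT t:?I|lborel. c powr \<alpha> - D * c) = (b - a) * (c powr \<alpha> - D * c)"
    using ab by (subst set_integral_const) auto
  moreover have "(LINT t:?I|lborel. g t) = (b - a) * c"
    using ab by (simp add: c_def)
  moreover have "(b - a) * (c powr \<alpha> - D * c) + D * ((b - a) * c) = (b - a) * c powr \<alpha>"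
    by (simp add: algebra_simps)
  ultimately show ?thesis using ab by (simp add: c_def[symmetric] set_integral_mult_right)
qed

section \<open>Auxiliary facts on sums, integrals and feasible schedules\<close>

lemma sum_mult_of_bool_diff:
  fixes g :: "'a \<Rightarrow> real"
  assumes "finite S" "a \<in> S" "b \<in> S"
  shows "(\<Sum>p\<in>S. g p * (of_bool (p = a) - of_bool (p = b))) = g a - g b"
proof -
  have "S \<inter> {p. p = a} = {a}" "S \<inter> {p. p = b} = {b}" using assms by auto
  then show ?thesis using assms(1) by (simp add: right_diff_distrib sum_subtractf)
qed

lemma set_integral_mono_set_nonneg:
  fixes f :: "'a \<Rightarrow> real"
  assumes "set_integrable M B f" "A \<subseteq> B" "\<And>t. 0 \<le> f t"
  shows "(LINT t:A|M. f t) \<le> (LINT t:B|M. f t)"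
  using assms unfolding set_lebesgue_integral_def set_integrable_def
  by (intro integral_mono') (auto simp: indicator_def)

lemma feasibleD:
  assumes "feasible \<alpha> w r d J S"
  shows "speed S \<in> borel_measurable borel" "0 \<le> speed S t"
    "integrable lborel (\<lambda>t. speed S t powr \<alpha>)" "exec_times S j \<in> sets borel"
    "j \<notin> J \<Longrightarrow> exec_times S j = {}"
    "j \<in> J \<Longrightarrow> exec_times S j \<subseteq> {r j..d j}"
    "j \<in> J \<Longrightarrow> set_integrable lborel (exec_times S j) (speed S)"
    "j \<in> J \<Longrightarrow> (LINT t:exec_times S j|lborel. speed S t) = w j"
proof -
  have "job S \<in> borel \<rightarrow>\<^sub>M count_space UNIV" using assms by (simp add: feasible_def)
  from measurable_sets[OF this, of "{Some j}"] show "exec_times S j \<in> sets borel"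
    by (simp add: exec_times_def vimage_def)
qed (use assms in \<open>auto simp: feasible_def exec_times_def\<close>)

subsection \<open>Work plans on the grid of release times and deadlines\<close>

text \<open>The job set is any finite set, so that both the full instance and the one without job
  \<open>i\<close> are interpretations.\<close>

locale speed_scaling =
  fixes \<alpha> :: real and w r d :: "nat \<Rightarrow> real" and J :: "nat set"
  assumes alpha: "1 \<le> \<alpha>" and fin: "finite J"
    and w_nonneg: "\<And>j. j \<in> J \<Longrightarrow> 0 \<le> w j" and rd: "\<And>j. j \<in> J \<Longrightarrow> r j < d j"
begin

definition grid :: "real set" where
  "grid = r ` J \<union> d ` J"

text \<open>The last grid point lies in no job's window, so \<open>a + 1\<close> is an arbitrary
  choice that keeps slice lengths positive.\<close>

definition nxt :: "real \<Rightarrow> real" where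
  "nxt a = (if {p \<in> grid. a < p} = {} then a + 1 else Min {p \<in> grid. a < p})"

definition slice :: "real \<Rightarrow> real set" where
  "slice a = {a..<nxt a}"

definition window :: "nat \<Rightarrow> real set" where
  "window j = {a \<in> grid. r j \<le> a \<and> a < d j}"

lemma finite_grid [simp]: "finite grid"
  using fin by (simp add: grid_def)

lemma finite_window [simp]: "finite (window j)"
  by (simp add: window_def)

lemma r_in_grid: "j \<in> J \<Longrightarrow> r j \<in> grid" and d_in_grid: "j \<in> J \<Longrightarrow> d j \<in> grid"
  by (auto simp: grid_def)

lemma nxt_gt: "a < nxt a"
  by (auto simp: nxt_def)

lemma nxt_le: "p \<in> grid \<Longrightarrow> a < p \<Longrightarrow> nxt a \<le> p"
  by (auto simp: nxt_def)

lemma slice_measurable [measurable, simp]: "slice a \<in> sets borel"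
  by (simp add: slice_def)

lemma slice_unique: "a \<in> grid \<Longrightarrow> b \<in> grid \<Longrightarrow> t \<in> slice a \<Longrightarrow> t \<in> slice b \<Longrightarrow> a = b"
  using nxt_le[of a b] nxt_le[of b a] by (fastforce simp: slice_def not_less[symmetric])

lemma disjoint_slices: "disjoint_family_on slice grid"
  using slice_unique by (auto simp: disjoint_family_on_def)

text \<open>Release times and deadlines are grid points, so no slice straddles an end of the
  window.\<close>

lemma UN_window:
  assumes "j \<in> J"
  shows "(\<Union>a\<in>window j. slice a) = {r j..<d j}"
proof (intro equalityI subsetI)
  fix t assume "t \<in> (\<Union>a\<in>window j. slice a)"
  then show "t \<in> {r j..<d j}"
    using nxt_le[OF d_in_grid[OF assms]] by (fastforce simp: window_def slice_def)
next
  fix t assume t: "t \<in> {r j..<d j}"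
  \<comment> \<open>The slice containing \<open>t\<close> starts at the largest grid point up to
    \<open>t\<close>.\<close>
  let ?A = "{p \<in> grid. p \<le> t}"
  have r: "r j \<in> ?A" using t r_in_grid[OF assms] by simp
  have M: "Max ?A \<in> ?A" using r by (intro Max_in) auto
  have "r j \<le> Max ?A" using r by (intro Max_ge) auto
  moreover have "t < nxt (Max ?A)"
  proof (cases "{p \<in> grid. Max ?A < p} = {}")
    case True
    then show ?thesis using t d_in_grid[OF assms] M by fastforce
  next
    case False
    then have "Min {p \<in> grid. Max ?A < p} \<in> {p \<in> grid. Max ?A < p}" by (intro Min_in) auto
    then have "nxt (Max ?A) \<in> grid" "Max ?A < nxt (Max ?A)" using False by (auto simp: nxt_def)
    then show ?thesis using Max_ge[of ?A "nxt (Max ?A)"] by (force simp: not_less[symmetric])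
  qed
  ultimately show "t \<in> (\<Union>a\<in>window j. slice a)"
    using M t by (intro UN_I[of "Max ?A"]) (auto simp: window_def slice_def)
qed

section \<open>Plans, their cost, and existence of a best plan\<close>

text \<open>\<open>x (j, a)\<close> is the work done on job \<open>j\<close> in the slice starting
  at \<open>a\<close>. Forcing all other coordinates to 0 makes the set compact in the product
  topology.\<close>

definition plans :: "(nat \<times> real \<Rightarrow> real) set" where
  "plans = {x. (\<forall>p. 0 \<le> x p) \<and> (\<forall>j a. x (j, a) \<noteq> 0 \<longrightarrow> j \<in> J \<and> a \<in> window j)
     \<and> (\<forall>j\<in>J. (\<Sum>a\<in>grid. x (j, a)) = w j)}"

definition rate :: "(nat \<times> real \<Rightarrow> real) \<Rightarrow> real \<Rightarrow> real" where
  "rate x a = (\<Sum>j\<in>J. x (j, a)) / (nxt a - a)"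

text \<open>This is the energy when each slice runs at the constant speed that just does its
  work.\<close>

definition cost :: "(nat \<times> real \<Rightarrow> real) \<Rightarrow> real" where
  "cost x = (\<Sum>a\<in>grid. (nxt a - a) * rate x a powr \<alpha>)"

text \<open>More urgent jobs have larger rank and hence weigh more in \<open>delay\<close>.\<close>

definition rank :: "nat \<Rightarrow> nat" where
  "rank j = card {m \<in> J. precedes d j m}"

text \<open>
  Among plans of minimum cost, one minimising the following objective is EDF: shifting
  urgent work to earlier slices decreases it.
\<close>
definition delay :: "(nat \<times> real \<Rightarrow> real) \<Rightarrow> real" where
  "delay x = (\<Sum>j\<in>J. \<Sum>a\<in>grid. real (rank j) * a * x (j, a))"

lemma plans_nonneg: "x \<in> plans \<Longrightarrow> 0 \<le> x p"
  and plans_window: "x \<in> plans \<Longrightarrow> x (j, a) \<noteq> 0 \<Longrightarrow> j \<in> J \<and> a \<in> window j"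
  and plans_sum: "x \<in> plans \<Longrightarrow> j \<in> J \<Longrightarrow> (\<Sum>a\<in>grid. x (j, a)) = w j"
  unfolding plans_def by blast+

lemma rate_nonneg: "x \<in> plans \<Longrightarrow> 0 \<le> rate x a"
  using nxt_gt[of a] by (simp add: rate_def plans_nonneg sum_nonneg)

lemma plans_nonempty: "plans \<noteq> {}"
proof -
  \<comment> \<open>Each job does all its work in the slice starting at its release time.\<close>
  have "(\<lambda>(j, a). if j \<in> J \<and> a = r j then w j else 0) \<in> plans"
    using w_nonneg rd by (auto simp: plans_def window_def r_in_grid)
  then show ?thesis by blast
qed

text \<open>A closed subset of a product of compact intervals, by Tychonoff's theorem.\<close>

lemma compact_plans: "compact plans"
proof -
  \<comment> \<open>The \<open>max 0\<close> keeps 0 in the interval for indices outside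
    \<open>J\<close>, where \<open>w\<close> is unconstrained.\<close>
  define B where "B = PiE UNIV (\<lambda>p :: nat \<times> real. {0..max 0 (w (fst p))})"
  have "compact B"
    using compactin_PiE[of "\<lambda>_. euclidean" UNIV "\<lambda>p :: nat \<times> real. {0..max 0 (w (fst p))}"]
    by (simp add: B_def euclidean_product_topology)
  have coord: "continuous_on UNIV (\<lambda>x :: nat \<times> real \<Rightarrow> real. x p)" for p
    by simp
  have "closed plans"
  proof -
    have eq: "plans = (\<Inter>p. {x. 0 \<le> x p})
      \<inter> (\<Inter>p \<in> - {(j, a). j \<in> J \<and> a \<in> window j}. {x. x p = 0})
      \<inter> (\<Inter>j\<in>J. {x. (\<Sum>a\<in>grid. x (j, a)) = w j})"
      unfolding plans_def by auto
    show ?thesis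
      unfolding eq
      by (intro closed_Int closed_INT ballI closed_Collect_le closed_Collect_eq continuous_on_sum
          continuous_on_const coord)
  qed
  moreover have "plans \<subseteq> B"
  proof
    fix x assume x: "x \<in> plans"
    have "x (j, a) \<le> max 0 (w j)" for j a
    proof (cases "x (j, a) = 0")
      case False
      then have "j \<in> J" "a \<in> grid" using plans_window[OF x] by (auto simp: window_def)
      then have "x (j, a) \<le> w j"
        using plans_nonneg[OF x] plans_sum[OF x] member_le_sum[of a grid "\<lambda>a. x (j, a)"] by simp
      then show ?thesis by simp
    qed simp
    then show "x \<in> B" using plans_nonneg[OF x] by (auto simp: B_def)
  qed
  ultimately show ?thesis
    using \<open>compact B\<close> compact_Int_closed[of B plans] by (simp add: Int_absorb1)
qed

text \<open>Lexicographic minimisation: \<open>cost\<close> attains its minimum on the compact set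
  of plans, then \<open>delay\<close> attains its minimum on the compact set \<open>M\<close> of
  cost minimisers.\<close>

lemma ex_best_plan:
  "\<exists>x\<in>plans. (\<forall>y\<in>plans. cost x \<le> cost y) \<and> (\<forall>y\<in>plans. cost y = cost x \<longrightarrow> delay x \<le> delay y)"
proof -
  have coord: "continuous_on plans (\<lambda>x :: nat \<times> real \<Rightarrow> real. x p)" for p
    by (rule continuous_on_subset[OF continuous_on_product_coordinates]) simp
  have rate: "continuous_on plans (\<lambda>x. rate x a)" for a
    unfolding rate_def using nxt_gt[of a]
    by (intro continuous_on_divide continuous_on_sum continuous_on_const coord) auto
  have cost: "continuous_on plans cost"
    unfolding cost_def[abs_def]
  proof (intro continuous_on_sum continuous_on_mult continuous_on_const continuous_on_powr' rate ballI)
    fix x a assume "x \<in> plans"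
    then show "0 \<le> rate x a \<and> (rate x a = 0 \<longrightarrow> 0 < \<alpha>)"
      using rate_nonneg alpha by simp
  qed
  obtain x0 where x0: "x0 \<in> plans" "\<And>y. y \<in> plans \<Longrightarrow> cost x0 \<le> cost y"
    using continuous_attains_inf[OF compact_plans plans_nonempty cost] by blast
  define M where "M = {x \<in> plans. cost x \<le> cost x0}"
  have "closedin (top_of_set plans) M"
    using continuous_closedin_preimage[OF cost, of "{..cost x0}"]
    by (simp add: M_def vimage_def Int_def)
  then have "compact M"
    using closedin_compact[OF compact_plans] by blast
  have "M \<noteq> {}" using x0 by (auto simp: M_def)
  have "continuous_on plans delay"
    unfolding delay_def[abs_def]
    by (intro continuous_on_sum continuous_on_mult continuous_on_const coord)
  then have "continuous_on M delay"
    by (rule continuous_on_subset) (auto simp: M_def)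
  from continuous_attains_inf[OF \<open>compact M\<close> \<open>M \<noteq> {}\<close> this]
  obtain x where x: "x \<in> plans" "cost x \<le> cost x0"
    and min: "\<And>y. y \<in> plans \<Longrightarrow> cost y \<le> cost x0 \<Longrightarrow> delay x \<le> delay y"
    by (auto simp: M_def)
  show ?thesis
  proof (intro bexI[OF _ x(1)] conjI ballI impI)
    show "cost x \<le> cost y" if "y \<in> plans" for y
      using x(2) x0(2)[OF that] by (rule order_trans)
    show "delay x \<le> delay y" if "y \<in> plans" "cost y = cost x" for y
      using that x(2) by (intro min) simp_all
  qed
qed

section \<open>The exchange argument for earliest deadline first\<close>

lemma rank_less:
  assumes "j \<in> J" "i \<in> J" "precedes d j i"
  shows "rank i < rank j"
  unfolding rank_def using assms fin
  by (intro psubset_card_mono psubsetI) (auto simp: precedes_def)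

text \<open>Swapping work of \<open>j\<close> and \<open>i\<close> between the slices \<open>a\<close> and \<open>b\<close> keeps the load of every slice.\<close>
lemma best_plan_edf:
  assumes x: "x \<in> plans" and min: "\<And>y. y \<in> plans \<Longrightarrow> cost y = cost x \<Longrightarrow> delay x \<le> delay y"
    and "precedes d j i" and pos: "x (i, a) \<noteq> 0" "x (j, b) \<noteq> 0" and "r j \<le> a"
  shows "b \<le> a"
proof (rule ccontr)
  assume "\<not> b \<le> a"
  then have ab: "a < b" by simp
  have i: "i \<in> J" "a \<in> window i" and j: "j \<in> J" "b \<in> window j"
    using plans_window[OF x] pos by auto
  have "i \<noteq> j" "d j \<le> d i" using assms(3) by (auto simp: precedes_def)
  \<comment> \<open>Both moves are legal: \<open>r j \<le> a < b < d j\<close> and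
    \<open>r i \<le> a < b < d j \<le> d i\<close>.\<close>
  have win: "a \<in> window j" "b \<in> window i"
    using i j ab \<open>r j \<le> a\<close> \<open>d j \<le> d i\<close> by (auto simp: window_def)
  have grid: "a \<in> grid" "b \<in> grid" using i j by (auto simp: window_def)
  define \<delta> where "\<delta> = min (x (i, a)) (x (j, b))"
  have \<delta>: "0 < \<delta>" "\<delta> \<le> x (i, a)" "\<delta> \<le> x (j, b)"
    using pos plans_nonneg[OF x, of "(i, a)"] plans_nonneg[OF x, of "(j, b)"]
    by (auto simp: \<delta>_def)
  define u where "u m = (of_bool (m = j) - of_bool (m = i) :: real)" for m
  define v where "v p = (of_bool (p = a) - of_bool (p = b) :: real)" for p
  \<comment> \<open>Move \<open>\<delta>\<close> of job \<open>j\<close> from \<open>b\<close> to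
    \<open>a\<close> and as much of job \<open>i\<close> from \<open>a\<close> to \<open>b\<close>;
    \<open>\<delta>\<close> is the largest amount that keeps \<open>y\<close> nonnegative.\<close>
  define y where "y = (\<lambda>(m, p). x (m, p) + \<delta> * u m * v p)"
  have sv: "(\<Sum>p\<in>grid. v p) = 0" "(\<Sum>p\<in>grid. p * v p) = a - b"
    using sum_mult_of_bool_diff[OF finite_grid grid, of "\<lambda>_. 1"]
      sum_mult_of_bool_diff[OF finite_grid grid, of "\<lambda>p. p"] by (simp_all add: v_def)
  have su: "(\<Sum>m\<in>J. u m) = 0" "(\<Sum>m\<in>J. real (rank m) * u m) = real (rank j) - real (rank i)"
    using sum_mult_of_bool_diff[OF fin j(1) i(1), of "\<lambda>_. 1"]
      sum_mult_of_bool_diff[OF fin j(1) i(1), of rank] by (simp_all add: u_def)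
  have ypos: "0 \<le> y (m, p)" for m p
    using \<delta> plans_nonneg[OF x, of "(m, p)"] ab \<open>i \<noteq> j\<close>
    by (auto simp: y_def u_def v_def)
  have "y \<in> plans"
    unfolding plans_def
  proof (intro CollectI conjI allI impI ballI)
    show "0 \<le> y p" for p using ypos by (cases p) simp
    fix m p assume y: "y (m, p) \<noteq> 0"
    have "x (m, p) \<noteq> 0 \<or> (m = i \<or> m = j) \<and> (p = a \<or> p = b)"
      using y by (auto simp: y_def u_def v_def split: if_splits)
    then have "m \<in> J \<and> p \<in> window m" using plans_window[OF x] i j win by blast
    then show "m \<in> J" "p \<in> window m" by auto
  next
    fix m assume "m \<in> J"
    then show "(\<Sum>p\<in>grid. y (m, p)) = w m"
      using plans_sum[OF x] sv by (simp add: y_def sum.distrib sum_distrib_left[symmetric])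
  qed
  moreover have "cost y = cost x"
    using su by (simp add: cost_def rate_def y_def sum.distrib sum_distrib_left[symmetric]
        sum_distrib_right[symmetric])
  ultimately have "delay x \<le> delay y" by (rule min)
  \<comment> \<open>The perturbation is a product, so the double sum factors: one factor is positive
    since \<open>j\<close> has the larger rank, the other is \<open>a - b < 0\<close>.\<close>
  moreover have "delay y = delay x + \<delta> * (\<Sum>m\<in>J. real (rank m) * u m) * (\<Sum>p\<in>grid. p * v p)"
    unfolding sum_distrib_left sum_distrib_right delay_def y_def
    by (simp add: sum.distrib algebra_simps) (rule sum.swap)
  moreover have "\<delta> * (real (rank j) - real (rank i)) * (a - b) < 0"
    using \<delta> ab rank_less[OF j(1) i(1) assms(3)] by (intro mult_pos_neg) auto
  ultimately show False unfolding su sv by simp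
qed

subsection \<open>From plans to schedules\<close>

text \<open>Within a slice jobs run in EDF order; this is the work scheduled there ahead of job
  \<open>j\<close>.\<close>

definition start :: "(nat \<times> real \<Rightarrow> real) \<Rightarrow> nat \<Rightarrow> real \<Rightarrow> real" where
  "start x j a = (\<Sum>i | i \<in> J \<and> precedes d i j. x (i, a))"

text \<open>In an idle slice the rate is 0, and the division by it yields the empty slot.\<close>
definition slot :: "(nat \<times> real \<Rightarrow> real) \<Rightarrow> nat \<Rightarrow> real \<Rightarrow> real set" where
  "slot x j a = {a + start x j a / rate x a ..< a + (start x j a + x (j, a)) / rate x a}"

definition busy :: "(nat \<times> real \<Rightarrow> real) \<Rightarrow> nat \<Rightarrow> real set" where
  "busy x j = (\<Union>a\<in>grid. slot x j a)"

definition sched :: "(nat \<times> real \<Rightarrow> real) \<Rightarrow> schedule" where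
  "sched x = \<lparr>speed = (\<lambda>t. \<Sum>a\<in>grid. rate x a * indicator (slice a) t),
     job = (\<lambda>t. if \<exists>j\<in>J. t \<in> busy x j then Some (THE j. j \<in> J \<and> t \<in> busy x j) else None)\<rparr>"

lemma speed_sched: "speed (sched x) t = (\<Sum>a\<in>grid. rate x a * indicator (slice a) t)"
  by (simp add: sched_def)

lemma speed_sched_slice:
  assumes "a \<in> grid" "t \<in> slice a"
  shows "speed (sched x) t = rate x a"
proof -
  have "speed (sched x) t = (\<Sum>b\<in>grid. if b = a then rate x a else 0)"
    unfolding speed_sched using assms
    by (intro sum.cong) (auto simp: indicator_def dest: slice_unique)
  then show ?thesis using assms by simp
qed

text \<open>At most one summand is nonzero, so the power passes inside the sum; off all slices both
  sides are 0.\<close>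

lemma speed_sched_powr:
  "speed (sched x) t powr \<alpha> = (\<Sum>a\<in>grid. rate x a powr \<alpha> * indicator (slice a) t)"
proof (cases "\<exists>a\<in>grid. t \<in> slice a")
  case True
  then obtain a where a: "a \<in> grid" "t \<in> slice a" by blast
  have "(\<Sum>b\<in>grid. rate x b powr \<alpha> * indicator (slice b) t)
      = (\<Sum>b\<in>grid. if b = a then rate x a powr \<alpha> else 0)"
    using a by (intro sum.cong) (auto simp: indicator_def dest: slice_unique)
  then show ?thesis using a by (simp add: speed_sched_slice)
next
  case False
  then have "speed (sched x) t = 0" "(\<Sum>a\<in>grid. rate x a powr \<alpha> * indicator (slice a) t) = 0"
    by (auto simp: speed_sched intro!: sum.neutral)
  then show ?thesis by simp
qed

lemma slice_emeasure: "emeasure lborel (slice a) = ennreal (nxt a - a)"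
  using nxt_gt[of a] by (simp add: slice_def)

lemma integrable_slice: "integrable lborel (\<lambda>t. c * indicator (slice a) t :: real)"
  by (intro integrable_mult_right integrable_real_indicator) (auto simp: slice_emeasure)

lemma energy_sched:
  "integrable lborel (\<lambda>t. speed (sched x) t powr \<alpha>)" "energy \<alpha> (sched x) = cost x"
proof -
  show "integrable lborel (\<lambda>t. speed (sched x) t powr \<alpha>)"
    unfolding speed_sched_powr by (intro Bochner_Integration.integrable_sum integrable_slice)
  have "measure lborel (slice a) = nxt a - a" for a
    using nxt_gt[of a] by (simp add: slice_def)
  then show "energy \<alpha> (sched x) = cost x"
    unfolding energy_def speed_sched_powr cost_def
    by (subst Bochner_Integration.integral_sum) (auto intro!: integrable_slice simp: mult.commute slice_emeasure)
qed

lemma precedes_total: "i \<noteq> j \<Longrightarrow> precedes d i j \<or> precedes d j i"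
  by (auto simp: precedes_def)

lemma start_nonneg: "x \<in> plans \<Longrightarrow> 0 \<le> start x j a"
  by (simp add: start_def plans_nonneg sum_nonneg)

lemma start_mono:
  assumes "x \<in> plans" "j \<in> J" "precedes d j i"
  shows "start x j a + x (j, a) \<le> start x i a"
proof -
  have "start x j a + x (j, a) = (\<Sum>m \<in> insert j {m. m \<in> J \<and> precedes d m j}. x (m, a))"
    unfolding start_def using fin by (subst sum.insert) (auto simp: precedes_def)
  also have "\<dots> \<le> start x i a"
    unfolding start_def using assms fin
    by (intro sum_mono2) (auto simp: plans_nonneg precedes_def)
  finally show ?thesis .
qed

lemma start_le_total:
  assumes "x \<in> plans" "j \<in> J"
  shows "start x j a + x (j, a) \<le> (\<Sum>j\<in>J. x (j, a))"
proof -
  have "start x j a + x (j, a) = (\<Sum>m \<in> insert j {m. m \<in> J \<and> precedes d m j}. x (m, a))"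
    unfolding start_def using fin by (subst sum.insert) (auto simp: precedes_def)
  also have "\<dots> \<le> (\<Sum>j\<in>J. x (j, a))"
    using assms fin by (intro sum_mono2) (auto simp: plans_nonneg)
  finally show ?thesis .
qed

lemma slot_nonzero:
  assumes "x \<in> plans" "t \<in> slot x j a"
  shows "x (j, a) \<noteq> 0" "rate x a > 0"
  using assms rate_nonneg[OF assms(1), of a] by (auto simp: slot_def less_le)

text \<open>At speed \<open>rate x a\<close> the work of all jobs together takes exactly the length
  of the slice, so no slot overruns its end.\<close>

lemma slot_subset_slice:
  assumes x: "x \<in> plans" and "j \<in> J"
  shows "slot x j a \<subseteq> slice a"
proof
  fix t assume t: "t \<in> slot x j a"
  have r: "0 < rate x a" using slot_nonzero[OF x t] by simp
  have "(\<Sum>j\<in>J. x (j, a)) = rate x a * (nxt a - a)"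
    using nxt_gt[of a] by (simp add: rate_def)
  then have "start x j a + x (j, a) \<le> (nxt a - a) * rate x a"
    using start_le_total[OF assms, of a] by (simp add: mult.commute)
  then have "(start x j a + x (j, a)) / rate x a \<le> nxt a - a"
    using r by (simp add: pos_divide_le_eq)
  moreover have "0 \<le> start x j a / rate x a" using start_nonneg[OF x] r by simp
  ultimately show "t \<in> slice a" using t by (auto simp: slot_def slice_def)
qed

lemma slot_order:
  assumes x: "x \<in> plans" and "j \<in> J" "precedes d j i" and t: "t \<in> slot x i a" and u: "u \<in> slot x j a"
  shows "u < t"
proof -
  have "(start x j a + x (j, a)) / rate x a \<le> start x i a / rate x a"
    using slot_nonzero[OF x t] by (intro divide_right_mono start_mono assms) auto
  then show ?thesis using t u by (auto simp: slot_def)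
qed

text \<open>Slices are disjoint, and inside one slice the slots of distinct jobs are ordered. This
  justifies the \<open>THE\<close> in \<open>sched\<close>.\<close>

lemma busy_unique:
  assumes x: "x \<in> plans" and "i \<in> J" "j \<in> J" "t \<in> busy x i" "t \<in> busy x j"
  shows "i = j"
proof -
  obtain a b where ab: "a \<in> grid" "t \<in> slot x i a" "b \<in> grid" "t \<in> slot x j b"
    using assms by (auto simp: busy_def)
  then have "a = b" using slot_subset_slice[OF x] assms by (intro slice_unique[of a b t]) auto
  then show ?thesis
    using slot_order[OF x \<open>i \<in> J\<close>, of j t a t] slot_order[OF x \<open>j \<in> J\<close>, of i t a t] ab
      precedes_total[of i j] by blast
qed

lemma job_sched:
  assumes "x \<in> plans"
  shows "job (sched x) t = Some j \<longleftrightarrow> j \<in> J \<and> t \<in> busy x j"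
proof -
  have "(THE j. j \<in> J \<and> t \<in> busy x j) = i" if "i \<in> J" "t \<in> busy x i" for i
    using that busy_unique[OF assms] by (intro the_equality) auto
  then show ?thesis by (auto simp: sched_def)
qed

lemma exec_times_sched: "x \<in> plans \<Longrightarrow> j \<in> J \<Longrightarrow> exec_times (sched x) j = busy x j"
  by (simp add: exec_times_def job_sched)

lemma slot_measurable [measurable, simp]: "slot x j a \<in> sets borel"
  by (simp add: slot_def)

lemma busy_measurable [measurable, simp]: "busy x j \<in> sets borel"
  unfolding busy_def by (intro sets.finite_UN) auto

lemma slot_work:
  assumes x: "x \<in> plans" and j: "j \<in> J" and a: "a \<in> grid"
  shows "set_integrable lborel (slot x j a) (speed (sched x))"
    and "(LINT t:slot x j a|lborel. speed (sched x) t) = x (j, a)"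
proof -
  have s: "speed (sched x) t = rate x a" if "t \<in> slot x j a" for t
    using that slot_subset_slice[OF x j] speed_sched_slice[OF a] by blast
  have r: "0 \<le> rate x a" using rate_nonneg[OF x] .
  have len: "measure lborel (slot x j a) = x (j, a) / rate x a"
    using r plans_nonneg[OF x, of "(j, a)"] by (simp add: slot_def add_divide_distrib)
  have em: "emeasure lborel (slot x j a) < \<infinity>"
    unfolding slot_def by (intro emeasure_bounded_finite bounded_Ico)
  have "set_integrable lborel (slot x j a) (\<lambda>_. rate x a)"
    unfolding set_integrable_def using em by simp
  then show "set_integrable lborel (slot x j a) (speed (sched x))"
    using s by (subst set_integrable_cong[where f' = "\<lambda>_. rate x a"]) auto
  have "(LINT t:slot x j a|lborel. speed (sched x) t) = (LINT t:slot x j a|lborel. rate x a)"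
    using s by (intro set_lebesgue_integral_cong) auto
  also have "\<dots> = x (j, a) / rate x a * rate x a"
    using em by (subst set_integral_const) (auto simp: len)
  also have "\<dots> = x (j, a)"
  \<comment> \<open>With rate 0 the left side is 0 by convention; then the nonnegative works in the
    slice sum to 0, so \<open>x (j, a)\<close> is 0 too.\<close>
  proof (cases "rate x a = 0")
    case True
    then have "(\<Sum>i\<in>J. x (i, a)) = 0" using nxt_gt[of a] by (simp add: rate_def)
    then have "x (j, a) = 0" using j fin plans_nonneg[OF x] by (simp add: sum_nonneg_eq_0_iff)
    then show ?thesis by simp
  qed simp
  finally show "(LINT t:slot x j a|lborel. speed (sched x) t) = x (j, a)" .
qed

lemma feasible_sched:
  assumes x: "x \<in> plans"
  shows "feasible \<alpha> w r d J (sched x)"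
  unfolding feasible_def
proof (intro conjI allI ballI impI)
  have "(\<lambda>t. \<Sum>a\<in>grid. rate x a * indicator (slice a) t) \<in> borel_measurable borel"
    by measurable
  then show "speed (sched x) \<in> borel_measurable borel"
    unfolding sched_def by (simp only: schedule.simps)
  show "job (sched x) \<in> borel \<rightarrow>\<^sub>M count_space UNIV"
  \<comment> \<open>The target is countable, so preimages of single values suffice.\<close>
  proof (subst measurable_count_space_eq2_countable, intro conjI ballI)
    fix k :: "nat option"
    have some: "job (sched x) -` {Some j} = (if j \<in> J then busy x j else {})" for j
      using job_sched[OF x] by auto
    have "job (sched x) -` {None} = UNIV - (\<Union>j\<in>J. busy x j)"
      by (auto simp: sched_def split: if_splits)
    moreover have "UNIV - (\<Union>j\<in>J. busy x j) \<in> sets borel"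
      using fin by (intro sets.Diff sets.finite_UN) auto
    ultimately show "job (sched x) -` {k} \<inter> space borel \<in> sets borel"
      using some by (cases k) auto
  qed auto
  show "0 \<le> speed (sched x) t" for t
    unfolding speed_sched by (intro sum_nonneg mult_nonneg_nonneg rate_nonneg[OF x]) auto
  show "integrable lborel (\<lambda>t. speed (sched x) t powr \<alpha>)" by (rule energy_sched)
  show "j \<in> J" if "job (sched x) t = Some j" for t j using that job_sched[OF x] by simp
  fix j assume j: "j \<in> J"
  note ex = exec_times_sched[OF x j]
  show "exec_times (sched x) j \<subseteq> {r j..d j}"
  proof
    fix t assume "t \<in> exec_times (sched x) j"
    then obtain a where a: "a \<in> grid" "t \<in> slot x j a" by (auto simp: ex busy_def)
    \<comment> \<open>A nonempty slot has a nonzero plan entry, which only occurs inside the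
      window.\<close>
    then have "a \<in> window j" "t \<in> slice a"
      using plans_window[OF x slot_nonzero(1)[OF x a(2)]] subsetD[OF slot_subset_slice[OF x j] a(2)]
      by simp_all
    then have "t \<in> {r j..<d j}" unfolding UN_window[OF j, symmetric] by (rule UN_I)
    then show "t \<in> {r j..d j}" by simp
  qed
  show "set_integrable lborel (exec_times (sched x) j) (speed (sched x))"
    unfolding ex busy_def using slot_work[OF x j] by (intro set_integrable_UN) auto
  have "disjoint_family_on (slot x j) grid"
    using disjoint_slices slot_subset_slice[OF x j] unfolding disjoint_family_on_def by blast
  then have "(LINT t:exec_times (sched x) j|lborel. speed (sched x) t) = (\<Sum>a\<in>grid. x (j, a))"
    unfolding ex busy_def using slot_work[OF x j]
    by (subst set_integral_finite_Union) auto
  then show "(LINT t:exec_times (sched x) j|lborel. speed (sched x) t) = w j"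
    using plans_sum[OF x j] by simp
qed

text \<open>Every execution time of the preceding job is at most \<open>t\<close>: later slices are
  excluded by \<open>best_plan_edf\<close>, and within the same slice \<open>slot_order\<close>
  applies.\<close>

lemma edf_sched:
  assumes x: "x \<in> plans" and min: "\<And>y. y \<in> plans \<Longrightarrow> cost y = cost x \<Longrightarrow> delay x \<le> delay y"
  shows "edf w r d J (sched x)"
  unfolding edf_def
proof (intro allI impI)
  fix t i j
  assume *: "job (sched x) t = Some i \<and> j \<in> J \<and> r j \<le> t \<and> precedes d j i"
  then have j: "j \<in> J" and p: "precedes d j i" and "r j \<le> t" by auto
  from * obtain a where i: "i \<in> J" and a: "a \<in> grid" "t \<in> slot x i a"
    using job_sched[OF x] by (auto simp: busy_def)
  have ta: "t \<in> slice a" using slot_subset_slice[OF x i] a by blast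
  \<comment> \<open>The release time is a grid point, so it cannot lie strictly inside the slice of
    \<open>t\<close>.\<close>
  have ra: "r j \<le> a"
    using nxt_le[OF r_in_grid[OF j], of a] ta \<open>r j \<le> t\<close> by (force simp: slice_def)
  have "u \<le> t" if u: "u \<in> exec_times (sched x) j" for u
  proof -
    obtain b where b: "b \<in> grid" "u \<in> slot x j b"
      using u by (auto simp: exec_times_sched[OF x j] busy_def)
    have ub: "u \<in> slice b" using slot_subset_slice[OF x j] b by blast
    have "b \<le> a"
      using best_plan_edf[OF x min p] slot_nonzero[OF x] a b ra by blast
    then consider "b = a" | "b < a" by linarith
    then show ?thesis
    proof cases
      case 1
      then show ?thesis using slot_order[OF x j p a(2)] b by fastforce
    next
      case 2
      then show ?thesis using nxt_le[OF a(1), of b] ta ub by (auto simp: slice_def)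
    qed
  qed
  then have "exec_times (sched x) j \<inter> {..t} = exec_times (sched x) j" by auto
  moreover have "(LINT t:exec_times (sched x) j|lborel. speed (sched x) t) = w j"
    using feasible_sched[OF x] j by (simp add: feasible_def)
  ultimately show "w j \<le> work_until (sched x) j t" by (simp add: work_until_def)
qed

subsection \<open>Optimality and removal of a job\<close>

definition profile :: "schedule \<Rightarrow> nat \<times> real \<Rightarrow> real" where
  "profile S = (\<lambda>(j, a). if j \<in> J \<and> a \<in> window j
     then LINT t:exec_times S j \<inter> slice a|lborel. speed S t else 0)"

lemma profile_nonneg:
  assumes "feasible \<alpha> w r d K S"
  shows "0 \<le> profile S p"
  using feasibleD(2)[OF assms]
  by (auto simp: profile_def set_lebesgue_integral_def split: prod.split intro!: integral_nonneg_AE AE_I2)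

text \<open>The job set \<open>K\<close> may be smaller than \<open>J\<close>, so that a schedule
  without job \<open>i\<close> can be measured on the same grid.\<close>

lemma profile_sum:
  assumes S: "feasible \<alpha> w r d K S" and "j \<in> K" "K \<subseteq> J"
  shows "(\<Sum>a\<in>grid. profile S (j, a)) = w j"
proof -
  note F = feasibleD[OF S]
  have j: "j \<in> J" using assms by blast
  let ?E = "exec_times S j"
  note [measurable] = F(1) F(4)
  have "(\<Sum>a\<in>grid. profile S (j, a)) = (\<Sum>a\<in>window j. LINT t:?E \<inter> slice a|lborel. speed S t)"
    using j by (intro sum.mono_neutral_cong_right) (auto simp: profile_def window_def)
  also have "\<dots> = (LINT t:(\<Union>a\<in>window j. ?E \<inter> slice a)|lborel. speed S t)"
  proof (rule set_integral_finite_Union[symmetric])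
    show "disjoint_family_on (\<lambda>a. ?E \<inter> slice a) (window j)"
      using disjoint_slices unfolding disjoint_family_on_def window_def by blast
    show "set_integrable lborel (?E \<inter> slice a) (speed S)" for a
      using F(7)[OF \<open>j \<in> K\<close>] by (rule set_integrable_subset) auto
  qed auto
  also have "(\<Union>a\<in>window j. ?E \<inter> slice a) = ?E \<inter> {r j..<d j}"
    using UN_window[OF j] by blast
  also have "(LINT t:?E \<inter> {r j..<d j}|lborel. speed S t) = (LINT t:?E|lborel. speed S t)"
  proof (rule set_integral_cong_set)
    \<comment> \<open>The half-open slices miss only the deadline itself, a null set.\<close>
    have "AE t in lborel. t \<noteq> d j" by (rule AE_lborel_singleton)
    then show "AE t in lborel. t \<in> ?E \<longleftrightarrow> t \<in> ?E \<inter> {r j..<d j}"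
      by (rule AE_mp) (use F(6)[OF \<open>j \<in> K\<close>] in \<open>auto intro!: AE_I2\<close>)
  qed (auto simp: set_borel_measurable_def)
  also have "\<dots> = w j" using F(8) \<open>j \<in> K\<close> .
  finally show ?thesis .
qed

lemma profile_outside:
  assumes "feasible \<alpha> w r d K S" "j \<notin> K"
  shows "profile S (j, a) = 0"
  using feasibleD(5)[OF assms] by (simp add: profile_def set_lebesgue_integral_def)

lemma profile_in_plans:
  assumes "feasible \<alpha> w r d J S"
  shows "profile S \<in> plans"
proof -
  have "\<forall>p. 0 \<le> profile S p" using profile_nonneg[OF assms] by blast
  moreover have "\<forall>j a. profile S (j, a) \<noteq> 0 \<longrightarrow> j \<in> J \<and> a \<in> window j"
    by (simp add: profile_def)
  ultimately show ?thesis using profile_sum[OF assms] by (simp add: plans_def)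
qed

lemma speed_integrable_slice:
  assumes "feasible \<alpha> w r d K S"
  shows "set_integrable lborel (slice a) (speed S)"
  using feasibleD[OF assms] alpha
  by (intro set_integrable_powr_imp_set_integrable) (auto simp: slice_emeasure)

lemma profile_le:
  assumes S: "feasible \<alpha> w r d K S"
  shows "profile S (j, a) \<le> (LINT t:exec_times S j \<inter> slice a|lborel. speed S t)"
  using feasibleD(2)[OF S]
  by (auto simp: profile_def set_lebesgue_integral_def intro!: integral_nonneg_AE AE_I2)

text \<open>Distinct jobs run at disjoint times within the slice. Only an inequality: the speed may
  be positive while no job is processed.\<close>

lemma profile_load:
  assumes S: "feasible \<alpha> w r d K S"
  shows "(\<Sum>j\<in>J. profile S (j, a)) \<le> (LINT t:slice a|lborel. speed S t)"
proof -
  note F = feasibleD[OF S]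
  note [measurable] = F(1) F(4)
  note int = speed_integrable_slice[OF S, of a]
  have "(\<Sum>j\<in>J. profile S (j, a)) \<le> (\<Sum>j\<in>J. LINT t:exec_times S j \<inter> slice a|lborel. speed S t)"
    by (intro sum_mono profile_le[OF S])
  also have "\<dots> = (LINT t:(\<Union>j\<in>J. exec_times S j \<inter> slice a)|lborel. speed S t)"
  proof (rule set_integral_finite_Union[symmetric, OF fin])
    show "disjoint_family_on (\<lambda>j. exec_times S j \<inter> slice a) J"
      by (auto simp: disjoint_family_on_def exec_times_def)
    show "set_integrable lborel (exec_times S j \<inter> slice a) (speed S)" for j
      using int by (rule set_integrable_subset) auto
  qed auto
  also have "\<dots> \<le> (LINT t:slice a|lborel. speed S t)"
    using int F(2) by (intro set_integral_mono_set_nonneg) auto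
  finally show ?thesis .
qed

text \<open>Jensen's inequality on each slice. It concerns any speed function \<open>g\<close>, so
  that it also covers a mixture of two schedules' speeds.\<close>

lemma cost_le:
  assumes g: "g \<in> borel_measurable borel" "\<And>t. 0 \<le> g t" "integrable lborel (\<lambda>t. g t powr \<alpha>)"
    and x: "x \<in> plans" "\<And>a. a \<in> grid \<Longrightarrow> (\<Sum>j\<in>J. x (j, a)) \<le> (LINT t:slice a|lborel. g t)"
  shows "cost x \<le> (LINT t|lborel. g t powr \<alpha>)"
proof -
  have int: "set_integrable lborel A (\<lambda>t. g t powr \<alpha>)" if "A \<in> sets borel" for A
    unfolding set_integrable_def using g(3) that by (intro integrable_mult_indicator) auto
  have "cost x \<le> (\<Sum>a\<in>grid. LINT t:slice a|lborel. g t powr \<alpha>)"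
    unfolding cost_def
  proof (rule sum_mono)
    fix a assume a: "a \<in> grid"
    have "rate x a \<le> (LINT t:slice a|lborel. g t) / (nxt a - a)"
      unfolding rate_def using x(2)[OF a] nxt_gt[of a] by (simp add: divide_right_mono)
    then have "(nxt a - a) * rate x a powr \<alpha>
        \<le> (nxt a - a) * ((LINT t:slice a|lborel. g t) / (nxt a - a)) powr \<alpha>"
      using nxt_gt[of a] rate_nonneg[OF x(1), of a] alpha by (intro mult_left_mono powr_mono2) auto
    also have "\<dots> \<le> (LINT t:slice a|lborel. g t powr \<alpha>)"
      unfolding slice_def using g alpha nxt_gt by (intro Jensen_powr_interval) auto
    finally show "(nxt a - a) * rate x a powr \<alpha> \<le> (LINT t:slice a|lborel. g t powr \<alpha>)" .
  qed
  also have "\<dots> = (LINT t:(\<Union>a\<in>grid. slice a)|lborel. g t powr \<alpha>)"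
    using disjoint_slices int by (intro set_integral_finite_Union[symmetric]) auto
  also have "\<dots> \<le> (LINT t:UNIV|lborel. g t powr \<alpha>)"
    using int by (intro set_integral_mono_set_nonneg) auto
  finally show ?thesis by (simp add: set_lebesgue_integral_def)
qed

text \<open>The schedule of a best plan is optimal, since any feasible schedule costs at least as
  much as its own profile. This existence validates the choice in \<open>OPT\<close>.\<close>

lemma is_OPT_OPT: "is_OPT \<alpha> w r d J (OPT \<alpha> w r d J)"
proof -
  obtain x where x: "x \<in> plans" "\<And>y. y \<in> plans \<Longrightarrow> cost x \<le> cost y"
    "\<And>y. y \<in> plans \<Longrightarrow> cost y = cost x \<Longrightarrow> delay x \<le> delay y"
    using ex_best_plan by auto
  have "energy \<alpha> (sched x) \<le> energy \<alpha> T" if T: "feasible \<alpha> w r d J T" for T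
  proof -
    have "cost x \<le> cost (profile T)" by (rule x(2)[OF profile_in_plans[OF T]])
    also have "\<dots> \<le> energy \<alpha> T"
      unfolding energy_def
      by (rule cost_le[OF feasibleD(1-3)[OF T] profile_in_plans[OF T] profile_load[OF T]])
    finally show ?thesis by (simp add: energy_sched)
  qed
  then have "is_OPT \<alpha> w r d J (sched x)"
    using feasible_sched[OF x(1)] edf_sched[OF x(1,3)] unfolding is_OPT_def by blast
  then show ?thesis unfolding OPT_def by (rule someI)
qed

lemma OPT_feasible: "feasible \<alpha> w r d J (OPT \<alpha> w r d J)"
  and OPT_minimal: "feasible \<alpha> w r d J T \<Longrightarrow> energy \<alpha> (OPT \<alpha> w r d J) \<le> energy \<alpha> T"
  using is_OPT_OPT by (auto simp: is_OPT_def)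

section \<open>The upper bound by mixing two schedules\<close>

text \<open>The mixture is formed at the level of plans, and \<open>sched\<close> turns it back into
  a schedule. Its energy is bounded through the mixed speed \<open>g\<close> and a pointwise bound
  \<open>h\<close>.\<close>

lemma energy_OPT_mix:
  fixes e :: real
  assumes i: "i \<in> J" and T: "feasible \<alpha> w r d (J - {i}) T" and e: "0 < e" "e < 1"
  defines "S \<equiv> OPT \<alpha> w r d J"
  shows "energy \<alpha> S \<le> (1 - e) * energy \<alpha> S + e * energy \<alpha> T
    + ((1 - e) * (1 / (1 - e)) powr \<alpha> - (1 - e)) * job_energy \<alpha> S i"
proof -
  have S: "feasible \<alpha> w r d J S" unfolding S_def by (rule OPT_feasible)
  note FS = feasibleD[OF S] and FT = feasibleD[OF T]
  note [measurable] = FS(1,4) FT(1,4)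
  define s \<tau> A where "s = speed S" and "\<tau> = speed T" and "A = exec_times S i"
  have [measurable]: "s \<in> borel_measurable borel" "\<tau> \<in> borel_measurable borel" "A \<in> sets borel"
    by (simp_all add: s_def \<tau>_def A_def)
  have nn: "0 \<le> s t" "0 \<le> \<tau> t" for t using FS(2) FT(2) by (simp_all add: s_def \<tau>_def)
  define k where "k = (1 - e) * (1 / (1 - e)) powr \<alpha>"
  \<comment> \<open>While \<open>S\<close> runs job \<open>i\<close>, the extra term restores the
    full speed of \<open>S\<close>: there \<open>g = s + e * \<tau>\<close>.\<close>
  define g where "g t = (1 - e) * s t + e * \<tau> t + e * (indicator A t * s t)" for t
  define h where "h t = (1 - e) * s t powr \<alpha> + e * \<tau> t powr \<alpha>
    + (k - (1 - e)) * (indicator A t * s t powr \<alpha>)" for t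
  have gh: "g t powr \<alpha> \<le> h t" for t
  proof (cases "t \<in> A")
    case True
    \<comment> \<open>Writing \<open>s\<close> as \<open>1 - e\<close> times
      \<open>s / (1 - e)\<close> makes \<open>g\<close> a convex combination; this is the source of
      \<open>k\<close>.\<close>
    have "(1 - e) * (1 / (1 - e) * s t) = s t" using e by simp
    then have "g t = (1 - e) * (1 / (1 - e) * s t) + e * \<tau> t"
      using True by (simp add: g_def algebra_simps del: times_divide_eq_left times_divide_eq_right)
    also have "\<dots> powr \<alpha> \<le> (1 - e) * (1 / (1 - e) * s t) powr \<alpha> + e * \<tau> t powr \<alpha>"
      using alpha nn e by (intro powr_convex_combination mult_nonneg_nonneg) auto
    also have "(1 / (1 - e) * s t) powr \<alpha> = (1 / (1 - e)) powr \<alpha> * s t powr \<alpha>"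
      using e nn by (intro powr_mult)
    finally show ?thesis using True by (simp add: h_def k_def algebra_simps)
  next
    case False
    then show ?thesis
      using powr_convex_combination[OF alpha nn(1)[of t] nn(2)[of t], of e] e by (simp add: g_def h_def)
  qed
  have intS: "integrable lborel (\<lambda>t. s t powr \<alpha>)" and intT: "integrable lborel (\<lambda>t. \<tau> t powr \<alpha>)"
    using FS(3) FT(3) by (simp_all add: s_def \<tau>_def)
  have iA: "integrable lborel (\<lambda>t. indicator A t * s t powr \<alpha>)"
    using integrable_mult_indicator[OF _ intS, of A] by simp
  have ih: "integrable lborel h"
    unfolding h_def[abs_def] using intS intT iA by auto
  have h: "(LINT t|lborel. h t) = (1 - e) * energy \<alpha> S + e * energy \<alpha> T + (k - (1 - e)) * job_energy \<alpha> S i"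
    unfolding h_def energy_def job_energy_def set_lebesgue_integral_def s_def[symmetric] \<tau>_def[symmetric]
      A_def[symmetric] using intS intT iA by simp
  have gm: "g \<in> borel_measurable borel" unfolding g_def[abs_def] by measurable
  have g0: "0 \<le> g t" for t using nn e by (simp add: g_def)
  have ig: "integrable lborel (\<lambda>t. g t powr \<alpha>)"
    using ih by (rule Bochner_Integration.integrable_bound) (use gm order_trans[OF gh abs_ge_self] in \<open>auto intro!: AE_I2\<close>)
  \<comment> \<open>Job \<open>i\<close> takes its whole work from \<open>S\<close>, as
    \<open>T\<close> contributes none; every other job takes shares \<open>1 - e\<close> from
    \<open>S\<close> and \<open>e\<close> from \<open>T\<close>.\<close>
  define z where "z = (\<lambda>(j, a). (1 - e) * profile S (j, a) + e * profile T (j, a)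
    + e * (of_bool (j = i) * profile S (j, a)))"
  have z: "z \<in> plans"
    unfolding plans_def
  proof (intro CollectI conjI allI impI ballI)
    show "0 \<le> z p" for p
      using e profile_nonneg[OF S] profile_nonneg[OF T] by (cases p) (simp add: z_def)
    fix j a assume "z (j, a) \<noteq> 0"
    then show "j \<in> J" "a \<in> window j" by (auto simp: z_def profile_def split: if_splits)
  next
    fix j assume j: "j \<in> J"
    have "(\<Sum>a\<in>grid. z (j, a)) = (1 - e) * w j + e * (\<Sum>a\<in>grid. profile T (j, a)) + e * (of_bool (j = i) * w j)"
      using profile_sum[OF S j order_refl]
      by (simp add: z_def sum.distrib sum_distrib_left[symmetric])
    also have "\<dots> = w j"
      using profile_sum[OF T, of j] profile_outside[OF T, of i] j by (cases "j = i") (auto simp: algebra_simps)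
    finally show "(\<Sum>a\<in>grid. z (j, a)) = w j" .
  qed
  have load: "(\<Sum>j\<in>J. z (j, a)) \<le> (LINT t:slice a|lborel. g t)" for a
  proof -
    have sS: "set_integrable lborel (slice a) s" and sT: "set_integrable lborel (slice a) \<tau>"
      using speed_integrable_slice[OF S] speed_integrable_slice[OF T] by (simp_all add: s_def \<tau>_def)
    have sA: "set_integrable lborel (slice a) (\<lambda>t. indicator A t * s t)"
      using integrable_mult_indicator[OF _ sS[unfolded set_integrable_def], of A]
      by (simp add: set_integrable_def mult.left_commute)
    have "profile S (i, a) \<le> (LINT t:slice a|lborel. indicator A t * s t)"
      using profile_le[OF S, of i a]
      by (simp add: set_lebesgue_integral_def A_def s_def indicator_inter_arith mult.commute mult.left_commute)
    moreover have "(\<Sum>j\<in>J. z (j, a)) = (1 - e) * (\<Sum>j\<in>J. profile S (j, a))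
        + e * (\<Sum>j\<in>J. profile T (j, a)) + e * profile S (i, a)"
    proof -
      have "J \<inter> {j. j = i} = {i}" using i by auto
      then have "(\<Sum>j\<in>J. of_bool (j = i) * profile S (j, a)) = profile S (i, a)"
        using fin by simp
      then show ?thesis by (simp add: z_def sum.distrib sum_distrib_left[symmetric])
    qed
    ultimately have "(\<Sum>j\<in>J. z (j, a)) \<le> (1 - e) * (LINT t:slice a|lborel. s t)
        + e * (LINT t:slice a|lborel. \<tau> t) + e * (LINT t:slice a|lborel. indicator A t * s t)"
      using e profile_load[OF S, of a] profile_load[OF T, of a]
      by (simp only: s_def \<tau>_def) (intro add_mono mult_left_mono; simp)
    also have "\<dots> = (LINT t:slice a|lborel. g t)"
      unfolding g_def using sS sT sA by simp
    finally show ?thesis .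
  qed
  have "energy \<alpha> S \<le> energy \<alpha> (sched z)"
    unfolding S_def by (rule OPT_minimal[OF feasible_sched[OF z]])
  also have "\<dots> \<le> (LINT t|lborel. g t powr \<alpha>)"
    unfolding energy_sched by (rule cost_le[OF gm g0 ig z load])
  also have "\<dots> \<le> (LINT t|lborel. h t)"
    using ig ih gh by (intro integral_mono)
  finally show ?thesis unfolding h k_def .
qed

text \<open>Dividing \<open>energy_OPT_mix\<close> by \<open>e\<close> and letting \<open>e\<close> tend to 0 bounds the
  marginal share by the derivative of the mixed energy.\<close>
lemma energy_OPT_le_remove:
  assumes i: "i \<in> J" and T: "feasible \<alpha> w r d (J - {i}) T"
  shows "energy \<alpha> (OPT \<alpha> w r d J) - energy \<alpha> T \<le> \<alpha> * job_energy \<alpha> (OPT \<alpha> w r d J) i"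
proof -
  let ?S = "OPT \<alpha> w r d J"
  let ?q = "\<lambda>e :: real. ((1 - e) * (1 / (1 - e)) powr \<alpha> - (1 - e)) / e"
  \<comment> \<open>Near 0 the function is \<open>(1 - e) powr (1 - \<alpha>) - (1 - e)\<close>,
    with derivative \<open>(\<alpha> - 1) + 1\<close> at 0. It vanishes at 0, so \<open>?q\<close>
    is its difference quotient.\<close>
  have "((\<lambda>e. (1 - e) * (1 / (1 - e)) powr \<alpha> - (1 - e)) has_real_derivative \<alpha>) (at 0)"
    by (auto intro!: derivative_eq_intros)
  then have "(?q \<longlongrightarrow> \<alpha>) (at 0)"
    by (simp add: has_field_derivative_iff)
  then have "(?q \<longlongrightarrow> \<alpha>) (at_right 0)"
    by (rule filterlim_mono) (auto intro: at_le)
  then have "((\<lambda>e. ?q e * job_energy \<alpha> ?S i) \<longlongrightarrow> \<alpha> * job_energy \<alpha> ?S i) (at_right 0)"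
    by (intro tendsto_mult tendsto_const)
  moreover have "\<forall>\<^sub>F e in at_right 0. energy \<alpha> ?S - energy \<alpha> T \<le> ?q e * job_energy \<alpha> ?S i"
  proof -
    have "energy \<alpha> ?S - energy \<alpha> T \<le> ?q e * job_energy \<alpha> ?S i" if "0 < e" "e < 1" for e
    proof -
      define K where "K = (1 - e) * (1 / (1 - e)) powr \<alpha> - (1 - e)"
      have "(energy \<alpha> ?S - energy \<alpha> T) * e \<le> K * job_energy \<alpha> ?S i"
        using energy_OPT_mix[OF i T that, folded K_def] by (simp add: algebra_simps)
      then have "energy \<alpha> ?S - energy \<alpha> T \<le> K * job_energy \<alpha> ?S i / e"
        using that(1) by (simp add: pos_le_divide_eq)
      then show ?thesis by (simp add: K_def)
    qed
    then show ?thesis using eventually_at_right_less[of 0] by (auto simp: eventually_at_right_field intro!: exI[of _ 1])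
  qed
  ultimately show ?thesis by (rule tendsto_lowerbound) simp
qed

section \<open>Deleting a job, for the lower bound\<close>

definition remove :: "nat \<Rightarrow> schedule \<Rightarrow> schedule" where
  "remove i S = \<lparr>speed = (\<lambda>t. if t \<in> exec_times S i then 0 else speed S t),
     job = (\<lambda>t. if t \<in> exec_times S i then None else job S t)\<rparr>"

text \<open>Other jobs run at times disjoint from those of \<open>i\<close> and are unaffected;
  speed 0 costs nothing, so exactly the energy of job \<open>i\<close> is saved.\<close>

lemma
  assumes S: "feasible \<alpha> w r d J S"
  shows feasible_remove: "feasible \<alpha> w r d (J - {i}) (remove i S)"
    and energy_remove: "energy \<alpha> (remove i S) = energy \<alpha> S - job_energy \<alpha> S i"
proof -
  note F = feasibleD[OF S]
  note [measurable] = F(1,4)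
  have [measurable]: "job S \<in> borel \<rightarrow>\<^sub>M count_space UNIV" using S by (simp add: feasible_def)
  have ex: "exec_times (remove i S) j = (if j = i then {} else exec_times S j)" for j
    by (auto simp: remove_def exec_times_def)
  have eq: "speed (remove i S) t powr \<alpha> = speed S t powr \<alpha> - indicator (exec_times S i) t * speed S t powr \<alpha>" for t
    by (simp add: remove_def)
  have iA: "integrable lborel (\<lambda>t. indicator (exec_times S i) t * speed S t powr \<alpha>)"
    using integrable_mult_indicator[OF _ F(3), of "exec_times S i"] F(4) by simp
  have speed: "speed (remove i S) t = speed S t" if "t \<in> exec_times S j" "j \<noteq> i" for t j
    using that by (auto simp: remove_def exec_times_def)
  show "energy \<alpha> (remove i S) = energy \<alpha> S - job_energy \<alpha> S i"
    unfolding energy_def job_energy_def set_lebesgue_integral_def eq using iA F(3) by simp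
  show "feasible \<alpha> w r d (J - {i}) (remove i S)"
    unfolding feasible_def
  proof (intro conjI allI ballI impI)
    show "speed (remove i S) \<in> borel_measurable borel"
      unfolding remove_def by simp
    show "job (remove i S) \<in> borel \<rightarrow>\<^sub>M count_space UNIV"
      unfolding remove_def by simp
    show "0 \<le> speed (remove i S) t" for t using F(2) by (simp add: remove_def)
    show "integrable lborel (\<lambda>t. speed (remove i S) t powr \<alpha>)"
      unfolding eq using iA F(3) by simp
    show "j \<in> J - {i}" if "job (remove i S) t = Some j" for t j
      using that S by (auto simp: remove_def exec_times_def feasible_def split: if_splits)
  next
    fix j assume j: "j \<in> J - {i}"
    then have e: "exec_times (remove i S) j = exec_times S j" by (simp add: ex)
    show "exec_times (remove i S) j \<subseteq> {r j..d j}" using F(6) j by (simp add: e)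
    show "set_integrable lborel (exec_times (remove i S) j) (speed (remove i S))"
      unfolding e using F(7)[of j] j speed
      by (subst set_integrable_cong[where f' = "speed S"]) auto
    have "(LINT t:exec_times S j|lborel. speed (remove i S) t) = (LINT t:exec_times S j|lborel. speed S t)"
      using j speed by (intro set_lebesgue_integral_cong) auto
    then show "(LINT t:exec_times (remove i S) j|lborel. speed (remove i S) t) = w j"
      unfolding e using F(8)[of j] j by simp
  qed
qed

end

theorem theorem3:
  fixes \<alpha> :: real and n i :: nat and w r d :: "nat \<Rightarrow> real"
  assumes "2 \<le> \<alpha>" and "\<alpha> \<le> 3"
    and "\<And>j. j < n \<Longrightarrow> 0 < w j"
    and "\<And>j. j < n \<Longrightarrow> r j < d j"
    and "i < n"
  shows "proportional_share \<alpha> w r d {..<n} i \<le> marginal_share \<alpha> w r d {..<n} i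
    \<and> marginal_share \<alpha> w r d {..<n} i \<le> \<alpha> * proportional_share \<alpha> w r d {..<n} i"
proof -
  interpret full: speed_scaling \<alpha> w r d "{..<n}"
    using assms by unfold_locales (auto simp: less_imp_le)
  interpret rest: speed_scaling \<alpha> w r d "{..<n} - {i}"
    using assms by unfold_locales (auto simp: less_imp_le)
  \<comment> \<open>The full optimum with \<open>i\<close> deleted competes with the optimum of the
    remaining jobs.\<close>
  have "energy \<alpha> (OPT \<alpha> w r d ({..<n} - {i}))
      \<le> energy \<alpha> (OPT \<alpha> w r d {..<n}) - job_energy \<alpha> (OPT \<alpha> w r d {..<n}) i"
    using rest.OPT_minimal[OF full.feasible_remove[OF full.OPT_feasible]] full.energy_remove[OF full.OPT_feasible]
    by simp
  moreover have "energy \<alpha> (OPT \<alpha> w r d {..<n}) - energy \<alpha> (OPT \<alpha> w r d ({..<n} - {i}))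
      \<le> \<alpha> * job_energy \<alpha> (OPT \<alpha> w r d {..<n}) i"
    using \<open>i < n\<close> by (intro full.energy_OPT_le_remove rest.OPT_feasible) simp
  ultimately show ?thesis
    by (simp add: marginal_share_def proportional_share_def)
qed

end
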